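(* Let $f$ be a surface in the normal form described in the context, and let $\theta_1,\theta_2,\theta_3,\theta_4\in(0,\pi)$ be four distinct directions with $p(\theta_i)\ne0$ $(i=1,\dots,4)$, where $p(\theta)=a_{20}\cos^2\theta+a_{02}\sin^2\theta$. Let $\frac{dk_{\theta_i}}{ds}(0)$ be the derivative at the origin, with respect to arc-length, of the curvature of the contour of $f$ with respect to $\xi(\theta_i)=(\cos\theta_i,\sin\theta_i,0)$. Let $A=(\mathbf a_1,\mathbf a_2,\mathbf a_3,\mathbf a_4)$ be the $4\times4$ matrix whose columns have $i$-th entries $(i=1,\dots,4)$ $$(\mathbf a_1)_i=-a_{02}^3\sin^3\theta_i,\quad (\mathbf a_2)_i=3a_{20}a_{02}^2\sin^2\theta_i\cos\theta_i,\quad (\mathbf a_3)_i=-3a_{20}^2a_{02}\sin\theta_i\cos^2\theta_i,\quad (\mathbf a_4)_i=a_{20}^3\cos^3\theta_i,$$ and let $d$ be the column vector with entries $d_i=p(\theta_i)^3\frac{dk_{\theta_i}}{ds}(0)$. Then $\det A\neq0$ and the third order coefficients of $f$ are given by $$a_{30}=\frac{\det A_1}{\det A},\quad a_{21}=\frac{\det A_2}{\det A},\quad a_{12}=\frac{\det A_3}{\det A},\quad a_{03}=\frac{\det A_4}{\det A},$$ where $A_1=(d,\mathbf a_2,\mathbf a_3,\mathbf a_4)$, $A_2=(\mathbf a_1,d,\mathbf a_3,\mathbf a_4)$, $A_3=(\mathbf a_1,\mathbf a_2,d,\mathbf a_4)$, $A_4=(\mathbf a_1,\mathbf a_2,\mathbf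 a_3,d)$.
   Context: Surface: $U\subset\mathbb{R}^2$ is a neighborhood of $0=(0,0)$ and $f:U\to\mathbb{R}^3$ is a $C^\infty$ surface of the form $f(u,v)=(u,v,h(u,v))$ with $$h(u,v)=\frac{a_{20}}2u^2+\frac{a_{02}}2v^2+\sum_{i+j=3}\frac{a_{ij}}{i!\,j!}u^iv^j+\text{(terms of degree}\ge4),\qquad a_{20}a_{02}\ne0,\ a_{20}>a_{02},\ a_{20}>0.$$ Contours: for a unit vector $\xi$, $\pi_\xi(x)=x-\langle x,\xi\rangle\xi:\mathbb{R}^3\to\xi^\perp$. For $0<\theta<\pi$ put $\xi(\theta)=(\cos\theta,\sin\theta,0)$. The set $S=\{(u,v): \cos\theta\,h_u+\sin\theta\,h_v=0\}$ of singular points of $\pi_{\xi(\theta)}\circ f$ is the contour generator, and $(\pi_{\xi(\theta)}\circ f)(S)$ is the contour of $f$ with respect to $\xi(\theta)$. If $p(\theta)\ne0$, the contour is a regular curve near the origin. The plane $\xi(\theta)^\perp$ is oriented so that $X=(-\sin\theta,\cos\theta,0)$, $Y=(0,0,1)$ is a positive basis, the contour is oriented in the direction of $X$ at the origin, $s$ is its arc-length parameter with this orientation ($s=0$ at the origin), and $k_\theta$ is its signed curvature. *)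

theory Defs
  imports "HOL-Analysis.Analysis" "HOL-Library.Landau_Symbols"
begin

(* C^n on an open set of a finite-dimensional space: all iterated directional derivatives up to
   order n exist (in the Frechet sense) and are continuous. *)
primrec Ck_on :: "nat \<Rightarrow> 'a::euclidean_space set \<Rightarrow> ('a \<Rightarrow> 'b::real_normed_vector) \<Rightarrow> bool" where
  "Ck_on 0 S f \<longleftrightarrow> continuous_on S f"
| "Ck_on (Suc n) S f \<longleftrightarrow>
     (\<forall>x\<in>S. f differentiable (at x)) \<and> (\<forall>w. Ck_on n S (\<lambda>x. frechet_derivative f (at x) w))"

definition smooth_on :: "'a::euclidean_space set \<Rightarrow> ('a \<Rightarrow> 'b::real_normed_vector) \<Rightarrow> bool" where
  "smooth_on S f \<longleftrightarrow> (\<forall>n. Ck_on n S f)"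

type_synonym plane = "real \<times> real"
type_synonym space = "real \<times> real \<times> real"

(* The coefficients are a i j with i + j = 2 or i + j = 3; a 1 1 does not occur. For smooth h,
   "terms of degree at least 4" is a remainder of order O(|(u,v)|^4) at the origin. *)
definition normal_form :: "plane set \<Rightarrow> (plane \<Rightarrow> real) \<Rightarrow> (nat \<Rightarrow> nat \<Rightarrow> real) \<Rightarrow> bool" where
  "normal_form U h a \<longleftrightarrow>
     open U \<and> (0, 0) \<in> U \<and> smooth_on U h \<and>
     (\<lambda>(u, v). h (u, v) - (a 2 0 / 2 * u\<^sup>2 + a 0 2 / 2 * v\<^sup>2
         + (\<Sum>(i, j) \<in> {(i, j). i + j = 3}. a i j / (fact i * fact j) * u ^ i * v ^ j)))
       \<in> O[nhds (0, 0)](\<lambda>x. norm x ^ 4) \<and>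
     a 2 0 * a 0 2 \<noteq> 0 \<and> a 2 0 > a 0 2 \<and> a 2 0 > 0"

definition graph_surface :: "(plane \<Rightarrow> real) \<Rightarrow> plane \<Rightarrow> space" where
  "graph_surface h = (\<lambda>(u, v). (u, v, h (u, v)))"

definition view_dir :: "real \<Rightarrow> space" where
  "view_dir \<theta> = (cos \<theta>, sin \<theta>, 0)"

definition proj :: "space \<Rightarrow> space \<Rightarrow> space" where
  "proj \<xi> x = x - (x \<bullet> \<xi>) *\<^sub>R \<xi>"

definition frame_X :: "real \<Rightarrow> space" where
  "frame_X \<theta> = (- sin \<theta>, cos \<theta>, 0)"

definition frame_Y :: space where
  "frame_Y = (0, 0, 1)"

definition contour_generator :: "plane set \<Rightarrow> (plane \<Rightarrow> real) \<Rightarrow> real \<Rightarrow> plane set" where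
  "contour_generator U h \<theta> =
     {(u, v) \<in> U. cos \<theta> * deriv (\<lambda>t. h (t, v)) u + sin \<theta> * deriv (\<lambda>t. h (u, t)) v = 0}"

(* c is the contour near the origin, parametrized by arc length, with c 0 = 0 and oriented by
   frame_X at the origin. The parametrization factors through a curve g tracing out the contour
   generator S near (0, 0): it is the germ of S at (0, 0) that is projected, since other pieces of
   S may have contours passing through the origin as well. *)
definition arclength_contour ::
    "plane set \<Rightarrow> (plane \<Rightarrow> real) \<Rightarrow> real \<Rightarrow> (real \<Rightarrow> space) \<Rightarrow> bool" where
  "arclength_contour U h \<theta> c \<longleftrightarrow>
     (\<exists>\<epsilon> > 0. \<exists>V g.
        open V \<and> (0, 0) \<in> V \<and>
        smooth_on {-\<epsilon><..<\<epsilon>} g \<and> g 0 = (0, 0) \<and>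
        g ` {-\<epsilon><..<\<epsilon>} = contour_generator U h \<theta> \<inter> V \<and>
        (\<forall>s\<in>{-\<epsilon><..<\<epsilon>}. c s = proj (view_dir \<theta>) (graph_surface h (g s))) \<and>
        (\<forall>s\<in>{-\<epsilon><..<\<epsilon>}. norm (vector_derivative c (at s)) = 1) \<and>
        vector_derivative c (at 0) \<bullet> frame_X \<theta> > 0)"

(* Signed curvature of a unit-speed curve in the plane orthogonal to view_dir \<theta>: the second
   derivative against the unit normal obtained by rotating the tangent by +90 degrees with respect
   to the positive basis (frame_X \<theta>, frame_Y). *)
definition signed_curvature :: "real \<Rightarrow> (real \<Rightarrow> space) \<Rightarrow> real \<Rightarrow> real" where
  "signed_curvature \<theta> c s =
     (let T = vector_derivative c (at s);
          N = (T \<bullet> frame_X \<theta>) *\<^sub>R frame_Y - (T \<bullet> frame_Y) *\<^sub>R frame_X \<theta>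
      in vector_derivative (\<lambda>t. vector_derivative c (at t)) (at s) \<bullet> N)"

definition of_columns :: "real^4 \<Rightarrow> real^4 \<Rightarrow> real^4 \<Rightarrow> real^4 \<Rightarrow> real^4^4" where
  "of_columns b1 b2 b3 b4 = transpose (vector [b1, b2, b3, b4])"

lemma column_of_columns:
  "column 1 (of_columns b1 b2 b3 b4) = b1" "column 2 (of_columns b1 b2 b3 b4) = b2"
  "column 3 (of_columns b1 b2 b3 b4) = b3" "column 4 (of_columns b1 b2 b3 b4) = b4"
  by (simp_all add: of_columns_def column_def transpose_def vector_def vec_eq_iff)

end

theory Submission
  imports Defs
begin

text \<open>
  Put \<open>\<xi> = (cos \<theta>, sin \<theta>)\<close> and let \<open>g = (u, v)\<close> be the curve tracing out the contour
  generator, with \<open>x = cos \<theta> v - sin \<theta> u\<close> and \<open>y = h(u, v)\<close> the coordinates of the contour in the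
  frame \<open>X, Y\<close>. The surface is tangent to the \<open>(u, v)\<close>-plane at the origin, so \<open>y' = 0\<close> there, and
  unit speed forces \<open>x' = 1\<close> and \<open>x'' = 0\<close>. Since the curvature is \<open>x' y'' - x'' y'\<close>, its derivative
  at the origin is just \<open>y'''\<close>.

  Write \<open>B\<close> for the symmetric bilinear form \<open>diag(a20, a02)\<close> and \<open>C\<close> for the cubic form of the
  third order coefficients. Only the terms up to degree three of \<open>h\<close> contribute to \<open>y'''\<close>
  (\<open>derivative_zero_of_order\<close>), which gives \<open>y''' = C(g') + 3 B(g', g'')\<close>. The tangent \<open>g'\<close> of the contour
  generator is conjugate to the viewing direction, \<open>B(g', \<xi>) = 0\<close>
  (\<open>contour_generator_tangent_conjugate\<close>). Together with \<open>x' = 1\<close> this determines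
  \<open>g' = (-a02 sin \<theta>, a20 cos \<theta>) / p\<close>, and it makes \<open>B(g', g'')\<close> a multiple of \<open>x'' = 0\<close>. Hence
  \<open>p^3 dk/ds = C(-a02 sin \<theta>, a20 cos \<theta>)\<close> (\<open>curvature_derivative_arclength_contour\<close>).

  For four directions this is a linear system for the four coefficients of \<open>C\<close>, with matrix \<open>A\<close>.
  It is regular because a binary cubic form that vanishes on four distinct lines is zero
  (\<open>cubic_form_zero\<close>), and Cramer's rule solves it.
\<close>

section \<open>Iterated differentiability of real functions\<close>

text \<open>
  Derivatives are given by existence instead of iterating \<open>deriv\<close>: the closure properties below then
  follow by induction from the usual derivative rules.
\<close>
primrec ndiff_on :: "nat \<Rightarrow> real set \<Rightarrow> (real \<Rightarrow> real) \<Rightarrow> bool" where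
  "ndiff_on 0 I f \<longleftrightarrow> True"
| "ndiff_on (Suc n) I f \<longleftrightarrow>
     (\<exists>f'. (\<forall>s\<in>I. (f has_real_derivative f' s) (at s)) \<and> ndiff_on n I f')"

lemma ndiff_on_4E:
  assumes "ndiff_on 4 I f"
  obtains f1 f2 f3 f4 where
    "\<And>s. s \<in> I \<Longrightarrow> (f has_real_derivative f1 s) (at s)"
    "\<And>s. s \<in> I \<Longrightarrow> (f1 has_real_derivative f2 s) (at s)"
    "\<And>s. s \<in> I \<Longrightarrow> (f2 has_real_derivative f3 s) (at s)"
    "\<And>s. s \<in> I \<Longrightarrow> (f3 has_real_derivative f4 s) (at s)"
proof -
  obtain f1 f2 f3 f4 where "\<forall>s\<in>I. (f has_real_derivative f1 s) (at s)"
    "\<forall>s\<in>I. (f1 has_real_derivative f2 s) (at s)" "\<forall>s\<in>I. (f2 has_real_derivative f3 s) (at s)"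
    "\<forall>s\<in>I. (f3 has_real_derivative f4 s) (at s)"
    using assms by (auto simp: eval_nat_numeral)
  then show ?thesis
    by (intro that[of f1 f2 f3 f4]) auto
qed

lemma ndiff_on_Suc_imp: "ndiff_on (Suc n) I f \<Longrightarrow> ndiff_on n I f"
proof (induction n arbitrary: f)
  case (Suc n)
  then obtain f' where "\<forall>s\<in>I. (f has_real_derivative f' s) (at s)" "ndiff_on (Suc n) I f'"
    by auto
  with Suc.IH show ?case by auto
qed simp

lemma ndiff_on_add:
  "ndiff_on n I f \<Longrightarrow> ndiff_on n I g \<Longrightarrow> ndiff_on n I (\<lambda>s. f s + g s)"
proof (induction n arbitrary: f g)
  case (Suc n)
  then obtain f' g' where "\<forall>s\<in>I. (f has_real_derivative f' s) (at s)" "ndiff_on n I f'"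
    "\<forall>s\<in>I. (g has_real_derivative g' s) (at s)" "ndiff_on n I g'"
    by auto
  with Suc.IH[of f' g'] show ?case
    by (auto intro!: exI[of _ "\<lambda>s. f' s + g' s"] derivative_intros)
qed simp

lemma ndiff_on_mult:
  "ndiff_on n I f \<Longrightarrow> ndiff_on n I g \<Longrightarrow> ndiff_on n I (\<lambda>s. f s * g s)"
proof (induction n arbitrary: f g)
  case (Suc n)
  then obtain f' g' where fg: "\<forall>s\<in>I. (f has_real_derivative f' s) (at s)" "ndiff_on n I f'"
    "\<forall>s\<in>I. (g has_real_derivative g' s) (at s)" "ndiff_on n I g'"
    by auto
  have "ndiff_on n I f" "ndiff_on n I g"
    using Suc.prems ndiff_on_Suc_imp by blast+
  then have "ndiff_on n I (\<lambda>s. f' s * g s + f s * g' s)"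
    using fg by (intro ndiff_on_add Suc.IH)
  with fg show ?case
    by (auto intro!: exI[of _ "\<lambda>s. f' s * g s + f s * g' s"] derivative_eq_intros)
qed simp

lemma ndiff_on_linear_Ck_on:
  fixes L :: "'b::real_normed_vector \<Rightarrow> real"
  assumes "bounded_linear L"
  shows "Ck_on n I g \<Longrightarrow> ndiff_on n I (\<lambda>s. L (g s))"
proof (induction n arbitrary: g)
  case (Suc n)
  have "((\<lambda>s. L (g s)) has_real_derivative L (frechet_derivative g (at s) 1)) (at s)"
    if "s \<in> I" for s
  proof -
    have D: "(g has_derivative frechet_derivative g (at s)) (at s)"
      using Suc.prems that frechet_derivative_works by auto
    have lin: "frechet_derivative g (at s) t = t *\<^sub>R frechet_derivative g (at s) 1" for t
      using linear_scale[OF has_derivative_linear[OF D], of t 1] by simp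
    have "(\<lambda>t. L (frechet_derivative g (at s) t)) = (*) (L (frechet_derivative g (at s) 1))"
      by (rule ext, subst lin) (simp add: linear_scale[OF bounded_linear.linear[OF assms]])
    then show ?thesis
      unfolding has_field_derivative_def
      using bounded_linear.has_derivative[OF assms D] by (simp only:)
  qed
  moreover have "ndiff_on n I (\<lambda>s. L (frechet_derivative g (at s) 1))"
    using Suc by simp
  ultimately show ?case
    by (auto intro!: exI[of _ "\<lambda>s. L (frechet_derivative g (at s) 1)"])
qed simp

lemma ndiff_on_compose_Ck_on:
  fixes h :: "plane \<Rightarrow> real"
  assumes "\<And>s. s \<in> I \<Longrightarrow> (u s, v s) \<in> U"
  shows "Ck_on n U h \<Longrightarrow> ndiff_on n I u \<Longrightarrow> ndiff_on n I v \<Longrightarrow> ndiff_on n I (\<lambda>s. h (u s, v s))"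
proof (induction n arbitrary: h)
  case (Suc n)
  let ?D = "\<lambda>w x. frechet_derivative h (at x) w"
  obtain u' v' where u': "\<forall>s\<in>I. (u has_real_derivative u' s) (at s)" "ndiff_on n I u'"
    and v': "\<forall>s\<in>I. (v has_real_derivative v' s) (at s)" "ndiff_on n I v'"
    using Suc.prems by auto
  have "((\<lambda>s. h (u s, v s)) has_real_derivative
          ?D (1, 0) (u s, v s) * u' s + ?D (0, 1) (u s, v s) * v' s) (at s)" if s: "s \<in> I" for s
  proof -
    have D: "(h has_derivative frechet_derivative h (at (u s, v s))) (at (u s, v s))"
      using Suc.prems(1) assms[OF s] frechet_derivative_works by auto
    note lin = has_derivative_linear[OF D]
    have uv: "((\<lambda>s. (u s, v s)) has_derivative (\<lambda>t. (u' s * t, v' s * t))) (at s)"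
      using u' v' s by (auto intro!: has_derivative_Pair simp: has_field_derivative_def)
    have "frechet_derivative h (at (u s, v s)) (u' s * t, v' s * t) =
            (?D (1, 0) (u s, v s) * u' s + ?D (0, 1) (u s, v s) * v' s) * t" for t
    proof -
      have "(u' s * t, v' s * t) = (u' s * t) *\<^sub>R (1, 0) + (v' s * t) *\<^sub>R (0, 1)"
        by simp
      then show ?thesis
        by (simp only: linear_add[OF lin] linear_scale[OF lin]) (simp add: algebra_simps)
    qed
    then show ?thesis
      using has_derivative_compose[OF uv D] by (simp add: has_field_derivative_def)
  qed
  moreover have "ndiff_on n I (\<lambda>s. ?D (1, 0) (u s, v s) * u' s + ?D (0, 1) (u s, v s) * v' s)"
  proof (intro ndiff_on_add ndiff_on_mult u'(2) v'(2))
    have "ndiff_on n I u" "ndiff_on n I v"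
      using Suc.prems ndiff_on_Suc_imp by blast+
    then show "ndiff_on n I (\<lambda>s. ?D (1, 0) (u s, v s))" "ndiff_on n I (\<lambda>s. ?D (0, 1) (u s, v s))"
      using Suc.prems(1) by (auto intro!: Suc.IH)
  qed
  ultimately show ?case
    by (auto intro!: exI[of _ "\<lambda>s. ?D (1, 0) (u s, v s) * u' s + ?D (0, 1) (u s, v s) * v' s"])
qed simp

text \<open>
  If the derivatives below order \<open>k\<close> vanish, the Lagrange form of Taylor's formula reads
  \<open>d 0 s = d k z / k! * s^k\<close> with \<open>z\<close> between \<open>0\<close> and \<open>s\<close>. A bound by a higher power of \<open>s\<close> then forces
  \<open>d k z\<close> to tend to \<open>0\<close>, so induction on \<open>k\<close> applies. This is how the terms of degree at least four,
  known only through their size, drop out of all derivatives that matter.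
\<close>
lemma derivative_zero_of_order:
  fixes d :: "nat \<Rightarrow> real \<Rightarrow> real"
  assumes e: "e > 0"
    and der: "\<And>m s. m < n \<Longrightarrow> \<bar>s\<bar> < e \<Longrightarrow> (d m has_real_derivative d (Suc m) s) (at s)"
    and cont: "isCont (d n) 0"
    and ord: "d 0 \<in> O[at_right 0](\<lambda>s. s ^ Suc n)"
  shows "k \<le> n \<Longrightarrow> d k 0 = 0"
proof (induction k rule: less_induct)
  case (less k)
  have ck: "isCont (d k) 0"
    using cont der[of k 0] e less.prems DERIV_isCont by (cases "k = n") auto
  obtain K where K: "eventually (\<lambda>s. norm (d 0 s) \<le> K * norm (s ^ Suc n)) (at_right 0)"
    using ord by (elim landau_o.bigE)
  (* closed bounds on z, so that k = 0 is covered by z = s *)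
  have "\<exists>z. 0 \<le> z \<and> z \<le> s \<and> d 0 s = d k z / fact k * s ^ k" if s: "0 < s" "s < e" for s
  proof (cases "k = 0")
    case True
    then show ?thesis using s by (intro exI[of _ s]) auto
  next
    case False
    have "\<exists>t. 0 < t \<and> t < s \<and>
       d 0 s = (\<Sum>m<k. d m 0 / fact m * s ^ m) + d k t / fact k * s ^ k"
      by (rule Maclaurin) (use s False less.prems in \<open>auto intro!: der\<close>)
    moreover have "(\<Sum>m<k. d m 0 / fact m * s ^ m) = 0"
      using less by (intro sum.neutral) auto
    ultimately show ?thesis by (auto intro: less_imp_le)
  qed
  then obtain z where z: "\<And>s. 0 < s \<Longrightarrow> s < e \<Longrightarrow> 0 \<le> z s \<and> z s \<le> s \<and> d 0 s = d k (z s) / fact k * s ^ k"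
    by metis
  have ev: "eventually (\<lambda>s. 0 < s \<and> s < e) (at_right 0)"
    using e by (auto simp: eventually_at_right intro!: exI[of _ e])
  have "(z \<longlongrightarrow> 0) (at_right 0)"
    by (rule tendsto_sandwich[of "\<lambda>_. 0" _ _ "\<lambda>s. s"])
       (use ev z in \<open>auto elim!: eventually_mono intro!: tendsto_eq_intros\<close>)
  then have lim: "((\<lambda>s. d k (z s)) \<longlongrightarrow> d k 0) (at_right 0)"
    by (rule isCont_tendsto_compose[OF ck])
  have "((\<lambda>s. d k (z s)) \<longlongrightarrow> 0) (at_right 0)"
  proof (rule Lim_null_comparison)
    show "\<forall>\<^sub>F s in at_right 0. norm (d k (z s)) \<le> fact k * K * s ^ (Suc n - k)"
      using K ev
    proof eventually_elim
      case (elim s)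
      have "\<bar>d k (z s)\<bar> * s ^ k = fact k * \<bar>d 0 s\<bar>"
        using z[of s] elim by (auto simp: abs_mult)
      also have "\<dots> \<le> fact k * (K * s ^ Suc n)"
        using elim by (intro mult_left_mono) auto
      also have "s ^ Suc n = s ^ (Suc n - k) * s ^ k"
        using less.prems by (metis le_Suc_eq le_add_diff_inverse2 power_add)
      finally have "\<bar>d k (z s)\<bar> * s ^ k \<le> (fact k * K * s ^ (Suc n - k)) * s ^ k"
        by (simp add: ac_simps)
      then show ?case
        using elim by (simp add: mult_le_cancel_right)
    qed
    show "((\<lambda>s. fact k * K * s ^ (Suc n - k)) \<longlongrightarrow> 0) (at_right 0)"
      using less.prems by (auto intro!: tendsto_eq_intros)
  qed
  then show ?case
    using lim tendsto_unique[OF trivial_limit_at_right_real] by blast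
qed

section \<open>The surface near the origin\<close>

definition cubic_jet :: "(nat \<Rightarrow> nat \<Rightarrow> real) \<Rightarrow> real \<Rightarrow> real \<Rightarrow> real" where
  "cubic_jet a u v = a 2 0 / 2 * u\<^sup>2 + a 0 2 / 2 * v\<^sup>2
     + (a 3 0 / 6 * u ^ 3 + a 2 1 / 2 * u\<^sup>2 * v + a 1 2 / 2 * u * v\<^sup>2 + a 0 3 / 6 * v ^ 3)"

lemma normal_form_remainder:
  assumes "normal_form U h a"
  shows "(\<lambda>x. h x - cubic_jet a (fst x) (snd x)) \<in> O[nhds (0, 0)](\<lambda>x. norm x ^ 4)"
proof -
  have "{(i, j). i + j = 3} = {(3, 0), (2, 1), (1, 2), (0, 3 :: nat)}"
    by auto
  then have "(\<Sum>(i, j) \<in> {(i, j). i + j = 3}. a i j / (fact i * fact j) * u ^ i * v ^ j) =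
      a 3 0 / 6 * u ^ 3 + a 2 1 / 2 * u\<^sup>2 * v + a 1 2 / 2 * u * v\<^sup>2 + a 0 3 / 6 * v ^ 3" for u v
    by (simp add: fact_numeral)
  then show ?thesis
    using assms by (simp add: normal_form_def cubic_jet_def case_prod_unfold)
qed

text \<open>
  The remainder bound in the normal form is all that ties \<open>h\<close> to its coefficients; it is used only
  along curves that leave the origin at a finite velocity.
\<close>
lemma normal_form_remainder_curve:
  fixes u v :: "real \<Rightarrow> real"
  assumes "normal_form U h a"
    and u: "((\<lambda>s. u s / s) \<longlongrightarrow> \<alpha>) (at_right 0)" and v: "((\<lambda>s. v s / s) \<longlongrightarrow> \<beta>) (at_right 0)"
  shows "(\<lambda>s. h (u s, v s) - cubic_jet a (u s) (v s)) \<in> O[at_right 0](\<lambda>s. s ^ 4)"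
proof -
  have nz: "eventually (\<lambda>s::real. s \<noteq> 0) (at_right 0)"
    by (auto simp: eventually_at_filter)
  have 0: "(w \<longlongrightarrow> 0) (at_right 0)" if "((\<lambda>s. w s / s) \<longlongrightarrow> \<gamma>) (at_right 0)" for w :: "real \<Rightarrow> real" and \<gamma>
  proof (rule Lim_transform_eventually)
    show "((\<lambda>s. w s / s * s) \<longlongrightarrow> 0) (at_right 0)"
      by (rule tendsto_eq_intros that refl)+ simp
  qed (rule eventually_mono[OF nz], simp)
  have lim: "filterlim (\<lambda>s. (u s, v s)) (nhds (0, 0)) (at_right 0)"
    by (intro tendsto_Pair 0[OF u] 0[OF v])
  have "(\<lambda>s. norm (u s, v s)) \<in> O[at_right 0](\<lambda>s. s)"
  proof (rule bigoI_tendsto)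
    show "((\<lambda>s. norm (u s, v s) / s) \<longlongrightarrow> norm (\<alpha>, \<beta>)) (at_right 0)"
    proof (rule Lim_transform_eventually)
      show "((\<lambda>s. norm (u s / s, v s / s)) \<longlongrightarrow> norm (\<alpha>, \<beta>)) (at_right 0)"
        by (intro tendsto_norm tendsto_Pair u v)
      have "norm (u s / s, v s / s) = norm (u s, v s) / s" if "s > 0" for s
      proof -
        have "(u s / s, v s / s) = (1 / s) *\<^sub>R (u s, v s)" by simp
        then show ?thesis using that by (simp only: norm_scaleR) simp
      qed
      then show "\<forall>\<^sub>F s in at_right 0. norm (u s / s, v s / s) = norm (u s, v s) / s"
        by (auto simp: eventually_at_filter)
    qed
  qed (rule nz)
  then have "(\<lambda>s. norm (u s, v s) ^ 4) \<in> O[at_right 0](\<lambda>s. s ^ 4)"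
    by (rule landau_o.big_power)
  moreover have "(\<lambda>s. h (u s, v s) - cubic_jet a (u s) (v s)) \<in> O[at_right 0](\<lambda>s. norm (u s, v s) ^ 4)"
    using landau_o.big.compose[OF normal_form_remainder[OF assms(1)] lim] by simp
  ultimately show ?thesis
    using landau_o.big_trans by blast
qed

lemma normal_form_second_order:
  fixes u v :: "real \<Rightarrow> real"
  assumes "normal_form U h a"
    and u: "((\<lambda>s. u s / s) \<longlongrightarrow> \<alpha>) (at_right 0)" and v: "((\<lambda>s. v s / s) \<longlongrightarrow> \<beta>) (at_right 0)"
  shows "((\<lambda>s. h (u s, v s) / s\<^sup>2) \<longlongrightarrow> a 2 0 / 2 * \<alpha>\<^sup>2 + a 0 2 / 2 * \<beta>\<^sup>2) (at_right 0)"
proof -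
  have nz: "eventually (\<lambda>s::real. s \<noteq> 0) (at_right 0)"
    by (auto simp: eventually_at_filter)
  let ?R = "\<lambda>s. h (u s, v s) - cubic_jet a (u s) (v s)"
  let ?C = "\<lambda>x y. a 3 0 / 6 * x ^ 3 + a 2 1 / 2 * x\<^sup>2 * y + a 1 2 / 2 * x * y\<^sup>2 + a 0 3 / 6 * y ^ 3"
  have "(\<lambda>s. ?R s / s\<^sup>2) \<in> O[at_right 0](\<lambda>s. s ^ 4 / s\<^sup>2)"
    by (intro landau_o.big.divide_right normal_form_remainder_curve[OF assms] eventually_mono[OF nz]) auto
  also have "(\<lambda>s::real. s ^ 4 / s\<^sup>2) \<in> O[at_right 0](\<lambda>s. s\<^sup>2)"
    by (intro bigoI_tendsto[where c = 1] Lim_transform_eventually[OF tendsto_const] eventually_mono[OF nz])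
       (auto simp: field_simps eval_nat_numeral)
  also have "(\<lambda>s::real. s\<^sup>2) \<in> o[at_right 0](\<lambda>_. 1)"
    by (rule smalloI_tendsto) (auto intro!: tendsto_eq_intros)
  finally have R: "((\<lambda>s. ?R s / s\<^sup>2) \<longlongrightarrow> 0) (at_right 0)"
    by (auto dest: smalloD_tendsto)
  have J: "((\<lambda>s. a 2 0 / 2 * (u s / s)\<^sup>2 + a 0 2 / 2 * (v s / s)\<^sup>2 + s * ?C (u s / s) (v s / s))
      \<longlongrightarrow> a 2 0 / 2 * \<alpha>\<^sup>2 + a 0 2 / 2 * \<beta>\<^sup>2 + 0 * ?C \<alpha> \<beta>) (at_right 0)"
    by (intro tendsto_intros u v)
  have "((\<lambda>s. (a 2 0 / 2 * (u s / s)\<^sup>2 + a 0 2 / 2 * (v s / s)\<^sup>2 + s * ?C (u s / s) (v s / s)) + ?R s / s\<^sup>2)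
      \<longlongrightarrow> a 2 0 / 2 * \<alpha>\<^sup>2 + a 0 2 / 2 * \<beta>\<^sup>2) (at_right 0)"
    using tendsto_add[OF J R] by simp
  then show ?thesis
  proof (rule Lim_transform_eventually, intro eventually_mono[OF nz])
    fix s :: real assume s: "s \<noteq> 0"
    have "a 2 0 / 2 * (u s / s)\<^sup>2 + a 0 2 / 2 * (v s / s)\<^sup>2 + s * ?C (u s / s) (v s / s) =
        cubic_jet a (u s) (v s) / s\<^sup>2"
      using s by (simp add: cubic_jet_def power2_eq_square power3_eq_cube divide_simps)
    then show "a 2 0 / 2 * (u s / s)\<^sup>2 + a 0 2 / 2 * (v s / s)\<^sup>2 + s * ?C (u s / s) (v s / s)
        + ?R s / s\<^sup>2 = h (u s, v s) / s\<^sup>2"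
      by (simp add: diff_divide_distrib)
  qed
qed

lemma DERIV_slope_at_zero:
  fixes f :: "real \<Rightarrow> real"
  assumes "(f has_real_derivative D) (at 0)" "f 0 = 0"
  shows "((\<lambda>s. f s / s) \<longlongrightarrow> D) (at_right 0)"
  using assms by (auto simp: DERIV_def intro: tendsto_within_subset)

lemma directional_derivative:
  fixes f :: "'a::euclidean_space \<Rightarrow> real"
  assumes "f differentiable at (x + t *\<^sub>R w)"
  shows "((\<lambda>t. f (x + t *\<^sub>R w)) has_real_derivative frechet_derivative f (at (x + t *\<^sub>R w)) w) (at t)"
proof -
  have D: "(f has_derivative frechet_derivative f (at (x + t *\<^sub>R w))) (at (x + t *\<^sub>R w))"
    using assms frechet_derivative_works by blast
  have L: "((\<lambda>t. x + t *\<^sub>R w) has_derivative (\<lambda>r. r *\<^sub>R w)) (at t)"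
    by (auto intro!: derivative_eq_intros)
  show ?thesis
    using has_derivative_compose[OF L D]
    by (simp add: has_field_derivative_def linear_scale[OF has_derivative_linear[OF D]] mult_commute_abs)
qed

text \<open>
  The tangent of the contour generator is conjugate to \<open>w = (p, q)\<close>. Along the curve \<open>\<gamma> = (u, v)\<close> the
  derivative of \<open>h\<close> in direction \<open>w\<close> vanishes, so by Taylor's formula \<open>h(\<gamma> s + s w) - h(\<gamma> s - s w)\<close> is
  \<open>s^2 / 2\<close> times a difference of two values of the second derivative in direction \<open>w\<close> near the origin;
  divided by \<open>s^2\<close> it tends to \<open>0\<close>. By the normal form the same quotient tends to
  \<open>Q(\<gamma>' + w) - Q(\<gamma>' - w)\<close>, where \<open>Q\<close> is the quadratic part of \<open>h\<close>, and polarization turns this into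
  twice the bilinear form of the conclusion. Comparing values of \<open>h\<close> in this way avoids identifying the
  mixed second derivative of \<open>h\<close> from the remainder bound.
\<close>
lemma contour_generator_tangent_conjugate:
  fixes u v :: "real \<Rightarrow> real"
  assumes nf: "normal_form U h a" and e: "e > 0"
    and u0: "u 0 = 0" and v0: "v 0 = 0"
    and u: "(u has_real_derivative u1) (at 0)" and v: "(v has_real_derivative v1) (at 0)"
    and crit: "\<And>s. \<bar>s\<bar> < e \<Longrightarrow> frechet_derivative h (at (u s, v s)) (p, q) = 0"
  shows "a 2 0 * p * u1 + a 0 2 * q * v1 = 0"
proof -
  let ?w = "(p, q)"
  define D where "D = (\<lambda>x. frechet_derivative h (at x) ?w)"
  define H where "H = (\<lambda>x. frechet_derivative D (at x) ?w)"
  define \<psi> where "\<psi> = (\<lambda>s t. h ((u s, v s) + t *\<^sub>R ?w) - h ((u s, v s) + (- t) *\<^sub>R ?w))"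
  from nf have U: "open U" "(0, 0) \<in> U" and "Ck_on (Suc (Suc 0)) U h"
    unfolding normal_form_def smooth_on_def by blast+
  then have dh: "\<And>x. x \<in> U \<Longrightarrow> h differentiable at x" and dD: "\<And>x. x \<in> U \<Longrightarrow> D differentiable at x"
    and cH: "continuous_on U H"
    unfolding D_def H_def by auto
  obtain r where r: "r > 0" "ball (0, 0) r \<subseteq> U"
    using U open_contains_ball by blast
  have lim_uv: "((\<lambda>s. (u s, v s)) \<longlongrightarrow> (0, 0)) (at_right 0)"
    using DERIV_isCont[OF u] DERIV_isCont[OF v] u0 v0
    by (intro tendsto_Pair) (auto simp: isCont_def intro: tendsto_within_subset)
  have lim_seg: "((\<lambda>s. (u s, v s) + z s *\<^sub>R ?w) \<longlongrightarrow> (0, 0)) (at_right 0)"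
    if "(z \<longlongrightarrow> 0) (at_right 0)" for z
    using tendsto_add[OF lim_uv tendsto_scaleR[OF that tendsto_const, of ?w]] by simp
  have "eventually (\<lambda>s. norm (u s, v s) < r / 2) (at_right 0)"
    using order_tendstoD(2)[OF tendsto_norm[OF lim_uv], of "r / 2"] r by simp
  moreover have "eventually (\<lambda>s. s * norm ?w < r / 2) (at_right 0)"
    by (rule order_tendstoD(2)[where y = 0]) (use r in \<open>auto intro!: tendsto_eq_intros\<close>)
  moreover have "eventually (\<lambda>s. 0 < s \<and> s < e) (at_right 0)"
    using e by (auto simp: eventually_at_right intro!: exI[of _ e])
  ultimately have "eventually (\<lambda>s. \<exists>z. 0 \<le> z \<and> z \<le> s \<and>
      \<psi> s s / s\<^sup>2 = (H ((u s, v s) + z *\<^sub>R ?w) - H ((u s, v s) + (- z) *\<^sub>R ?w)) / 2) (at_right 0)"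
  proof eventually_elim
    case (elim s)
    have inU: "(u s, v s) + t *\<^sub>R ?w \<in> U" if t: "\<bar>t\<bar> \<le> s" for t
    proof -
      have "norm ((u s, v s) + t *\<^sub>R ?w) \<le> norm (u s, v s) + \<bar>t\<bar> * norm ?w"
        by (metis norm_triangle_ineq norm_scaleR)
      also have "\<dots> \<le> norm (u s, v s) + s * norm ?w"
        using t by (intro add_left_mono mult_right_mono) auto
      also have "\<dots> < r"
        using elim by linarith
      finally show ?thesis
        using r(2) by (auto simp: subset_iff dist_norm norm_minus_commute simp flip: zero_prod_def)
    qed
    (* \<psi> s is odd, and its first derivative at 0 is 0 because h is stationary at (u s, v s) in
       direction w; so the expansion starts at order two *)
    define \<psi>' where "\<psi>' = (\<lambda>m::nat. [\<psi> s,
      \<lambda>t. D ((u s, v s) + t *\<^sub>R ?w) + D ((u s, v s) + (- t) *\<^sub>R ?w),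
      \<lambda>t. H ((u s, v s) + t *\<^sub>R ?w) - H ((u s, v s) + (- t) *\<^sub>R ?w)] ! m)"
    have mirror: "((\<lambda>t. f ((u s, v s) + (- t) *\<^sub>R ?w)) has_real_derivative
        - frechet_derivative f (at ((u s, v s) + (- t) *\<^sub>R ?w)) ?w) (at t)"
      if "f differentiable at ((u s, v s) + (- t) *\<^sub>R ?w)" for f :: "plane \<Rightarrow> real" and t
      using DERIV_chain2[where f = "\<lambda>t. f ((u s, v s) + t *\<^sub>R ?w)" and g = uminus,
          OF directional_derivative[OF that] DERIV_minus[OF DERIV_ident]]
      by simp
    have der: "(\<psi>' m has_real_derivative \<psi>' (Suc m) t) (at t)" if "m < 2 \<and> 0 \<le> t \<and> t \<le> s" for m t
    proof -
      have "(u s, v s) + t *\<^sub>R ?w \<in> U" "(u s, v s) + (- t) *\<^sub>R ?w \<in> U"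
        using that by (intro inU; simp)+
      note * = DERIV_diff[OF directional_derivative[OF dh] mirror[OF dh], OF this]
        DERIV_add[OF directional_derivative[OF dD] mirror[OF dD], OF this]
      from that have "m = 0 \<or> m = 1" by auto
      then show ?thesis
        using * by (auto simp: \<psi>'_def \<psi>_def D_def H_def)
    qed
    have "\<exists>t. 0 < t \<and> t < s \<and>
        \<psi> s s = (\<Sum>m<2. \<psi>' m 0 / fact m * s ^ m) + \<psi>' 2 t / fact 2 * s ^ 2"
      by (rule Maclaurin[where f = "\<psi> s" and diff = \<psi>'])
        (use elim der in simp, simp, simp add: \<psi>'_def, use der in blast)
    then obtain t where t: "0 < t" "t < s"
      "\<psi> s s = (\<Sum>m<2. \<psi>' m 0 / fact m * s ^ m) + \<psi>' 2 t / fact 2 * s ^ 2" by blast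
    have "(\<Sum>m<2. \<psi>' m 0 / fact m * s ^ m) = 0"
      using crit[of s] elim by (simp add: \<psi>'_def \<psi>_def D_def eval_nat_numeral)
    with t have "\<psi> s s / s\<^sup>2 = \<psi>' 2 t / 2"
      by simp
    then show ?case
      using t by (intro exI[of _ t]) (auto simp: \<psi>'_def)
  qed
  then obtain z where z: "eventually (\<lambda>s. 0 \<le> z s \<and> z s \<le> s \<and>
      \<psi> s s / s\<^sup>2 = (H ((u s, v s) + z s *\<^sub>R ?w) - H ((u s, v s) + (- z s) *\<^sub>R ?w)) / 2) (at_right 0)"
    unfolding eventually_ex by blast
  have z0: "(z \<longlongrightarrow> 0) (at_right 0)"
    by (rule tendsto_sandwich[of "\<lambda>_. 0" _ _ "\<lambda>s. s"])
       (use z in \<open>auto elim!: eventually_mono intro!: tendsto_eq_intros\<close>)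
  have H0: "isCont H (0, 0)"
    using cH U by (simp add: continuous_on_eq_continuous_at)
  have "((\<lambda>s. (H ((u s, v s) + z s *\<^sub>R ?w) - H ((u s, v s) + (- z s) *\<^sub>R ?w)) / 2)
      \<longlongrightarrow> (H (0, 0) - H (0, 0)) / 2) (at_right 0)"
    using z0 by (intro tendsto_intros isCont_tendsto_compose[OF H0] lim_seg)
      (auto intro!: tendsto_eq_intros)
  then have "((\<lambda>s. \<psi> s s / s\<^sup>2) \<longlongrightarrow> (H (0, 0) - H (0, 0)) / 2) (at_right 0)"
    by (rule Lim_transform_eventually) (use z in \<open>auto elim!: eventually_mono\<close>)
  then have "((\<lambda>s. \<psi> s s / s\<^sup>2) \<longlongrightarrow> 0) (at_right 0)"
    by simp
  moreover have "((\<lambda>s. \<psi> s s / s\<^sup>2) \<longlongrightarrow>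
      (a 2 0 / 2 * (u1 + p)\<^sup>2 + a 0 2 / 2 * (v1 + q)\<^sup>2) - (a 2 0 / 2 * (u1 - p)\<^sup>2 + a 0 2 / 2 * (v1 - q)\<^sup>2))
      (at_right 0)"
  proof -
    have slope: "((\<lambda>s. (f s + s * k) / s) \<longlongrightarrow> f1 + k) (at_right 0)"
      if "f 0 = 0" "(f has_real_derivative f1) (at 0)" for f :: "real \<Rightarrow> real" and f1 k
    proof (rule Lim_transform_eventually)
      from DERIV_slope_at_zero[OF that(2,1)]
      show "((\<lambda>s. f s / s + k) \<longlongrightarrow> f1 + k) (at_right 0)"
        by (intro tendsto_intros)
    qed (auto simp: eventually_at_filter field_simps)
    have "((\<lambda>s. h (u s + s * p, v s + s * q) / s\<^sup>2 - h (u s + s * (- p), v s + s * (- q)) / s\<^sup>2) \<longlongrightarrow>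
      (a 2 0 / 2 * (u1 + p)\<^sup>2 + a 0 2 / 2 * (v1 + q)\<^sup>2)
      - (a 2 0 / 2 * (u1 + (- p))\<^sup>2 + a 0 2 / 2 * (v1 + (- q))\<^sup>2)) (at_right 0)"
      by (intro tendsto_diff normal_form_second_order[OF nf] slope u0 v0 u v)
    then show ?thesis
      by (simp add: \<psi>_def diff_divide_distrib)
  qed
  ultimately have "(a 2 0 / 2 * (u1 + p)\<^sup>2 + a 0 2 / 2 * (v1 + q)\<^sup>2)
      - (a 2 0 / 2 * (u1 - p)\<^sup>2 + a 0 2 / 2 * (v1 - q)\<^sup>2) = 0"
    using tendsto_unique[OF trivial_limit_at_right_real] by blast
  then have "2 * (a 2 0 * p * u1 + a 0 2 * q * v1) = 0"
    by (simp add: power2_eq_square field_simps)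
  then show ?thesis
    by simp
qed


section \<open>The contour and its curvature\<close>

lemma frame_has_vector_derivative:
  assumes "open I" "s \<in> I" and "\<And>s. s \<in> I \<Longrightarrow> c s = x s *\<^sub>R frame_X \<theta> + y s *\<^sub>R frame_Y"
    and "(x has_real_derivative x') (at s)" "(y has_real_derivative y') (at s)"
  shows "(c has_vector_derivative x' *\<^sub>R frame_X \<theta> + y' *\<^sub>R frame_Y) (at s)"
proof (rule has_vector_derivative_transform_within_open)
  show "((\<lambda>s. x s *\<^sub>R frame_X \<theta> + y s *\<^sub>R frame_Y) has_vector_derivative
      x' *\<^sub>R frame_X \<theta> + y' *\<^sub>R frame_Y) (at s)"
    using assms(4,5) by (auto intro!: derivative_eq_intros)
qed (use assms in auto)

lemma frame_inner:
  "(x *\<^sub>R frame_X \<theta> + y *\<^sub>R frame_Y) \<bullet> frame_X \<theta> = x"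
  "(x *\<^sub>R frame_X \<theta> + y *\<^sub>R frame_Y) \<bullet> frame_Y = y"
proof -
  have "frame_X \<theta> \<bullet> frame_X \<theta> = 1" "frame_X \<theta> \<bullet> frame_Y = 0"
    "frame_Y \<bullet> frame_X \<theta> = 0" "frame_Y \<bullet> frame_Y = 1"
    by (simp_all add: frame_X_def frame_Y_def flip: power2_eq_square)
  then show "(x *\<^sub>R frame_X \<theta> + y *\<^sub>R frame_Y) \<bullet> frame_X \<theta> = x"
    "(x *\<^sub>R frame_X \<theta> + y *\<^sub>R frame_Y) \<bullet> frame_Y = y"
    by (simp_all add: inner_add_left)
qed

text \<open>
  In coordinates the signed curvature is \<open>x' y'' - x'' y'\<close>; the terms \<open>x'' y''\<close> of its derivative cancel.
\<close>
lemma deriv_signed_curvature: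
  assumes I: "open I" "t \<in> I"
    and c: "\<And>s. s \<in> I \<Longrightarrow> c s = x s *\<^sub>R frame_X \<theta> + y s *\<^sub>R frame_Y"
    and x1: "\<And>s. s \<in> I \<Longrightarrow> (x has_real_derivative x1 s) (at s)"
    and x2: "\<And>s. s \<in> I \<Longrightarrow> (x1 has_real_derivative x2 s) (at s)"
    and x3: "(x2 has_real_derivative x3) (at t)"
    and y1: "\<And>s. s \<in> I \<Longrightarrow> (y has_real_derivative y1 s) (at s)"
    and y2: "\<And>s. s \<in> I \<Longrightarrow> (y1 has_real_derivative y2 s) (at s)"
    and y3: "(y2 has_real_derivative y3) (at t)"
  shows "deriv (signed_curvature \<theta> c) t = x1 t * y3 - x3 * y1 t"
proof (rule DERIV_imp_deriv, rule has_field_derivative_transform_within_open[OF _ I])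
  show "((\<lambda>s. x1 s * y2 s - x2 s * y1 s) has_real_derivative x1 t * y3 - x3 * y1 t) (at t)"
    using x2[OF I(2)] x3 y2[OF I(2)] y3 by (auto intro!: derivative_eq_intros)
  fix s assume s: "s \<in> I"
  have T: "vector_derivative c (at s) = x1 s *\<^sub>R frame_X \<theta> + y1 s *\<^sub>R frame_Y" if "s \<in> I" for s
    by (rule vector_derivative_at[OF frame_has_vector_derivative]) (use I c x1 y1 that in auto)
  have "vector_derivative (\<lambda>t. vector_derivative c (at t)) (at s) = x2 s *\<^sub>R frame_X \<theta> + y2 s *\<^sub>R frame_Y"
    by (rule vector_derivative_at[OF frame_has_vector_derivative]) (use I T x2 y2 s in auto)
  then show "x1 s * y2 s - x2 s * y1 s = signed_curvature \<theta> c s"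
    by (simp add: signed_curvature_def Let_def T[OF s] frame_inner inner_diff_right)
qed

definition cubic_jet_du :: "(nat \<Rightarrow> nat \<Rightarrow> real) \<Rightarrow> real \<Rightarrow> real \<Rightarrow> real" where
  "cubic_jet_du a u v = a 2 0 * u + a 3 0 / 2 * u\<^sup>2 + a 2 1 * u * v + a 1 2 / 2 * v\<^sup>2"

definition cubic_jet_dv :: "(nat \<Rightarrow> nat \<Rightarrow> real) \<Rightarrow> real \<Rightarrow> real \<Rightarrow> real" where
  "cubic_jet_dv a u v = a 0 2 * v + a 2 1 / 2 * u\<^sup>2 + a 1 2 * u * v + a 0 3 / 2 * v\<^sup>2"

lemma cubic_jet_derivatives:
  assumes u: "(u has_real_derivative u1 s) (at s)" "(u1 has_real_derivative u2 s) (at s)"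
      "(u2 has_real_derivative u3 s) (at s)"
    and v: "(v has_real_derivative v1 s) (at s)" "(v1 has_real_derivative v2 s) (at s)"
      "(v2 has_real_derivative v3 s) (at s)"
  shows "((\<lambda>s. cubic_jet a (u s) (v s)) has_real_derivative
      cubic_jet_du a (u s) (v s) * u1 s + cubic_jet_dv a (u s) (v s) * v1 s) (at s)" (is ?first)
    and "((\<lambda>s. cubic_jet_du a (u s) (v s) * u1 s + cubic_jet_dv a (u s) (v s) * v1 s) has_real_derivative
      (a 2 0 + a 3 0 * u s + a 2 1 * v s) * (u1 s)\<^sup>2 + 2 * (a 2 1 * u s + a 1 2 * v s) * u1 s * v1 s
      + (a 0 2 + a 1 2 * u s + a 0 3 * v s) * (v1 s)\<^sup>2
      + cubic_jet_du a (u s) (v s) * u2 s + cubic_jet_dv a (u s) (v s) * v2 s) (at s)" (is ?second)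
    and "((\<lambda>s. (a 2 0 + a 3 0 * u s + a 2 1 * v s) * (u1 s)\<^sup>2 + 2 * (a 2 1 * u s + a 1 2 * v s) * u1 s * v1 s
      + (a 0 2 + a 1 2 * u s + a 0 3 * v s) * (v1 s)\<^sup>2
      + cubic_jet_du a (u s) (v s) * u2 s + cubic_jet_dv a (u s) (v s) * v2 s) has_real_derivative
      a 3 0 * u1 s ^ 3 + 3 * a 2 1 * (u1 s)\<^sup>2 * v1 s + 3 * a 1 2 * u1 s * (v1 s)\<^sup>2 + a 0 3 * v1 s ^ 3
      + 3 * ((a 2 0 + a 3 0 * u s + a 2 1 * v s) * u1 s * u2 s
           + (a 2 1 * u s + a 1 2 * v s) * (u1 s * v2 s + u2 s * v1 s)
           + (a 0 2 + a 1 2 * u s + a 0 3 * v s) * v1 s * v2 s)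
      + cubic_jet_du a (u s) (v s) * u3 s + cubic_jet_dv a (u s) (v s) * v3 s) (at s)" (is ?third)
proof -
  have ju: "((\<lambda>s. cubic_jet_du a (u s) (v s)) has_real_derivative
      (a 2 0 + a 3 0 * u s + a 2 1 * v s) * u1 s + (a 2 1 * u s + a 1 2 * v s) * v1 s) (at s)"
    unfolding cubic_jet_du_def
    by (rule derivative_eq_intros u v refl | simp)+ (simp add: algebra_simps)
  have jv: "((\<lambda>s. cubic_jet_dv a (u s) (v s)) has_real_derivative
      (a 2 1 * u s + a 1 2 * v s) * u1 s + (a 0 2 + a 1 2 * u s + a 0 3 * v s) * v1 s) (at s)"
    unfolding cubic_jet_dv_def
    by (rule derivative_eq_intros u v refl | simp)+ (simp add: algebra_simps)
  show ?first
    unfolding cubic_jet_def cubic_jet_du_def cubic_jet_dv_def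
    by (rule derivative_eq_intros u v refl | simp)+ (simp add: field_simps power2_eq_square)
  show ?second
    by (rule derivative_eq_intros u v ju jv refl | simp)+ (simp add: algebra_simps power2_eq_square)
  show ?third
    by (rule derivative_eq_intros u v ju jv refl | simp)+
      (simp add: algebra_simps power2_eq_square power3_eq_cube)
qed


text \<open>
  The data \<open>p^3 dk/ds\<close> is the value of the cubic form of \<open>h\<close> at \<open>(- a02 sin \<theta>, a20 cos \<theta>)\<close>, which is
  \<open>p\<close> times the velocity of the contour generator at the origin.
\<close>
lemma curvature_derivative_arclength_contour:
  fixes a :: "nat \<Rightarrow> nat \<Rightarrow> real" and \<theta> :: real
  assumes nf: "normal_form U h a"
    and p_def: "p = a 2 0 * (cos \<theta>)\<^sup>2 + a 0 2 * (sin \<theta>)\<^sup>2" and p: "p \<noteq> 0"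
    and contour: "arclength_contour U h \<theta> c"
  shows "p ^ 3 * deriv (signed_curvature \<theta> c) 0 =
      a 3 0 * (- (a 0 2 * sin \<theta>)) ^ 3 + 3 * a 2 1 * (- (a 0 2 * sin \<theta>))\<^sup>2 * (a 2 0 * cos \<theta>)
      + 3 * a 1 2 * (- (a 0 2 * sin \<theta>)) * (a 2 0 * cos \<theta>)\<^sup>2 + a 0 3 * (a 2 0 * cos \<theta>) ^ 3"
proof -
  obtain \<epsilon> V g where \<epsilon>: "\<epsilon> > 0" and g: "smooth_on {-\<epsilon><..<\<epsilon>} g" "g 0 = (0, 0)"
    "g ` {-\<epsilon><..<\<epsilon>} = contour_generator U h \<theta> \<inter> V"
    and cg: "\<forall>s\<in>{-\<epsilon><..<\<epsilon>}. c s = proj (view_dir \<theta>) (graph_surface h (g s))"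
    and unit: "\<forall>s\<in>{-\<epsilon><..<\<epsilon>}. norm (vector_derivative c (at s)) = 1"
    and orient: "vector_derivative c (at 0) \<bullet> frame_X \<theta> > 0"
    using contour unfolding arclength_contour_def by blast
  define I where "I = {-\<epsilon><..<\<epsilon>}"
  have I: "open I" "0 \<in> I" and I_abs: "s \<in> I \<longleftrightarrow> \<bar>s\<bar> < \<epsilon>" for s
    using \<epsilon> by (auto simp: I_def)
  define u where "u = (\<lambda>s. fst (g s))"
  define v where "v = (\<lambda>s. snd (g s))"
  define x where "x = (\<lambda>s. cos \<theta> * v s - sin \<theta> * u s)"
  define y where "y = (\<lambda>s. h (u s, v s))"
  have g_uv: "g s = (u s, v s)" for s
    by (simp add: u_def v_def)
  have u0: "u 0 = 0" and v0: "v 0 = 0"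
    using g by (simp_all add: u_def v_def)
  have gen: "(u s, v s) \<in> contour_generator U h \<theta>" if "s \<in> I" for s
    using g(3) that by (auto simp flip: g_uv I_def)
  have in_U: "(u s, v s) \<in> U" if "s \<in> I" for s
    using gen[OF that] by (auto simp: contour_generator_def)

  have Ck: "Ck_on n U h" "Ck_on n I g" for n
    using nf g by (simp_all add: normal_form_def smooth_on_def I_def)
  have ndiff: "ndiff_on 4 I u" "ndiff_on 4 I v"
    unfolding u_def v_def
    by (intro ndiff_on_linear_Ck_on bounded_linear_fst bounded_linear_snd Ck)+
  have ndiff_y: "ndiff_on 4 I y"
    unfolding y_def by (intro ndiff_on_compose_Ck_on[OF in_U] Ck ndiff)
  obtain u1 u2 u3 u4 where
    u: "\<And>s. s \<in> I \<Longrightarrow> (u has_real_derivative u1 s) (at s)"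
      "\<And>s. s \<in> I \<Longrightarrow> (u1 has_real_derivative u2 s) (at s)"
      "\<And>s. s \<in> I \<Longrightarrow> (u2 has_real_derivative u3 s) (at s)"
      "\<And>s. s \<in> I \<Longrightarrow> (u3 has_real_derivative u4 s) (at s)"
    using ndiff_on_4E[OF ndiff(1)] by blast
  obtain v1 v2 v3 v4 where
    v: "\<And>s. s \<in> I \<Longrightarrow> (v has_real_derivative v1 s) (at s)"
      "\<And>s. s \<in> I \<Longrightarrow> (v1 has_real_derivative v2 s) (at s)"
      "\<And>s. s \<in> I \<Longrightarrow> (v2 has_real_derivative v3 s) (at s)"
      "\<And>s. s \<in> I \<Longrightarrow> (v3 has_real_derivative v4 s) (at s)"
    using ndiff_on_4E[OF ndiff(2)] by blast
  obtain y1 y2 y3 y4 where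
    y: "\<And>s. s \<in> I \<Longrightarrow> (y has_real_derivative y1 s) (at s)"
      "\<And>s. s \<in> I \<Longrightarrow> (y1 has_real_derivative y2 s) (at s)"
      "\<And>s. s \<in> I \<Longrightarrow> (y2 has_real_derivative y3 s) (at s)"
      "\<And>s. s \<in> I \<Longrightarrow> (y3 has_real_derivative y4 s) (at s)"
    using ndiff_on_4E[OF ndiff_y] by blast
  define x1 where "x1 = (\<lambda>s. cos \<theta> * v1 s - sin \<theta> * u1 s)"
  define x2 where "x2 = (\<lambda>s. cos \<theta> * v2 s - sin \<theta> * u2 s)"
  define x3 where "x3 = (\<lambda>s. cos \<theta> * v3 s - sin \<theta> * u3 s)"
  have x: "s \<in> I \<Longrightarrow> (x has_real_derivative x1 s) (at s)"
    "s \<in> I \<Longrightarrow> (x1 has_real_derivative x2 s) (at s)"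
    "s \<in> I \<Longrightarrow> (x2 has_real_derivative x3 s) (at s)" for s
    unfolding x_def x1_def x2_def x3_def
    by (auto intro!: derivative_eq_intros u v)
  have c: "c s = x s *\<^sub>R frame_X \<theta> + y s *\<^sub>R frame_Y" if "s \<in> I" for s
  proof -
    have "c s = (u s - (u s * cos \<theta> + v s * sin \<theta>) * cos \<theta>, v s - (u s * cos \<theta> + v s * sin \<theta>) * sin \<theta>, y s)"
      using cg that by (simp add: I_def g_uv proj_def view_dir_def graph_surface_def y_def)
    moreover have "u s - (u s * cos \<theta> + v s * sin \<theta>) * cos \<theta> = - (x s * sin \<theta>)"
      unfolding x_def using sin_cos_squared_add[of \<theta>] by algebra
    moreover have "v s - (u s * cos \<theta> + v s * sin \<theta>) * sin \<theta> = x s * cos \<theta>"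
      unfolding x_def using sin_cos_squared_add[of \<theta>] by algebra
    ultimately show ?thesis
      by (simp add: frame_X_def frame_Y_def)
  qed
  have T: "vector_derivative c (at s) = x1 s *\<^sub>R frame_X \<theta> + y1 s *\<^sub>R frame_Y" if "s \<in> I" for s
    by (rule vector_derivative_at[OF frame_has_vector_derivative[OF I(1) that c]])
      (use x y that in auto)

  have crit: "frechet_derivative h (at (u s, v s)) (cos \<theta>, sin \<theta>) = 0" if s: "s \<in> I" for s
  proof -
    have dh: "h differentiable at (u s, v s)"
      using Ck(1)[of 1] in_U[OF s] by simp
    have lin: "linear (frechet_derivative h (at (u s, v s)))"
      using dh by (rule linear_frechet_derivative)
    have "deriv (\<lambda>t. h (t, v s)) (u s) = frechet_derivative h (at (u s, v s)) (1, 0)"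
      using directional_derivative[of h "(0, v s)" "u s" "(1, 0)"] dh by (auto intro!: DERIV_imp_deriv)
    moreover have "deriv (\<lambda>t. h (u s, t)) (v s) = frechet_derivative h (at (u s, v s)) (0, 1)"
      using directional_derivative[of h "(u s, 0)" "v s" "(0, 1)"] dh by (auto intro!: DERIV_imp_deriv)
    ultimately have "cos \<theta> * frechet_derivative h (at (u s, v s)) (1, 0)
        + sin \<theta> * frechet_derivative h (at (u s, v s)) (0, 1) = 0"
      using gen[OF s] by (simp add: contour_generator_def)
    moreover have "(cos \<theta>, sin \<theta>) = cos \<theta> *\<^sub>R (1, 0) + sin \<theta> *\<^sub>R (0, 1 :: real)"
      by simp
    ultimately show ?thesis
      by (simp only: linear_add[OF lin] linear_scale[OF lin]) simp
  qed
  have conj: "a 2 0 * cos \<theta> * u1 0 + a 0 2 * sin \<theta> * v1 0 = 0"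
    by (rule contour_generator_tangent_conjugate[OF nf \<epsilon> u0 v0 u(1)[OF I(2)] v(1)[OF I(2)]])
      (use crit I_abs in auto)

  (* the successive derivatives of h minus its cubic jet along the contour generator *)
  define d where "d = (\<lambda>m::nat. [\<lambda>s. y s - cubic_jet a (u s) (v s),
    \<lambda>s. y1 s - (cubic_jet_du a (u s) (v s) * u1 s + cubic_jet_dv a (u s) (v s) * v1 s),
    \<lambda>s. y2 s - ((a 2 0 + a 3 0 * u s + a 2 1 * v s) * (u1 s)\<^sup>2 + 2 * (a 2 1 * u s + a 1 2 * v s) * u1 s * v1 s
      + (a 0 2 + a 1 2 * u s + a 0 3 * v s) * (v1 s)\<^sup>2
      + cubic_jet_du a (u s) (v s) * u2 s + cubic_jet_dv a (u s) (v s) * v2 s),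
    \<lambda>s. y3 s - (a 3 0 * u1 s ^ 3 + 3 * a 2 1 * (u1 s)\<^sup>2 * v1 s + 3 * a 1 2 * u1 s * (v1 s)\<^sup>2 + a 0 3 * v1 s ^ 3
      + 3 * ((a 2 0 + a 3 0 * u s + a 2 1 * v s) * u1 s * u2 s
           + (a 2 1 * u s + a 1 2 * v s) * (u1 s * v2 s + u2 s * v1 s)
           + (a 0 2 + a 1 2 * u s + a 0 3 * v s) * v1 s * v2 s)
      + cubic_jet_du a (u s) (v s) * u3 s + cubic_jet_dv a (u s) (v s) * v3 s)] ! m)"
  have d_zero: "d k 0 = 0" if "k \<le> 3" for k
  proof (rule derivative_zero_of_order[OF \<epsilon> _ _ _ that])
    fix m :: nat and s :: real assume "m < 3" and "\<bar>s\<bar> < \<epsilon>"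
    then have s: "s \<in> I" and "m = 0 \<or> m = 1 \<or> m = 2"
      using I_abs by auto
    note jet = cubic_jet_derivatives[where u = u and ?u1.0 = u1 and ?u2.0 = u2 and ?u3.0 = u3
        and v = v and ?v1.0 = v1 and ?v2.0 = v2 and ?v3.0 = v3, OF u(1-3)[OF s] v(1-3)[OF s], of a]
    show "(d m has_real_derivative d (Suc m) s) (at s)"
      using \<open>m = 0 \<or> m = 1 \<or> m = 2\<close> DERIV_diff[OF y(1)[OF s] jet(1)]
        DERIV_diff[OF y(2)[OF s] jet(2)] DERIV_diff[OF y(3)[OF s] jet(3)]
      by (elim disjE) (simp_all add: d_def eval_nat_numeral)
  next
    have "isCont f 0" if "f \<in> {u, u1, u2, u3, v, v1, v2, v3, y3}" for f
      using that u[OF I(2)] v[OF I(2)] y(4)[OF I(2)] by (auto intro: DERIV_isCont)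
    then show "isCont (d 3) 0"
      unfolding d_def cubic_jet_du_def cubic_jet_dv_def by simp
  next
    from normal_form_remainder_curve[OF nf DERIV_slope_at_zero[OF u(1)[OF I(2)] u0]
        DERIV_slope_at_zero[OF v(1)[OF I(2)] v0]]
    show "d 0 \<in> O[at_right 0](\<lambda>s. s ^ Suc 3)"
      by (simp add: d_def y_def)
  qed
  have y1_0: "y1 0 = 0"
    using d_zero[of 1] by (simp add: d_def u0 v0 cubic_jet_du_def cubic_jet_dv_def)
  have y3_0: "y3 0 = a 3 0 * u1 0 ^ 3 + 3 * a 2 1 * (u1 0)\<^sup>2 * v1 0 + 3 * a 1 2 * u1 0 * (v1 0)\<^sup>2 + a 0 3 * v1 0 ^ 3
      + 3 * (a 2 0 * u1 0 * u2 0 + a 0 2 * v1 0 * v2 0)"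
    using d_zero[of 3] by (simp add: d_def u0 v0 cubic_jet_du_def cubic_jet_dv_def eval_nat_numeral)

  have speed: "(x1 s)\<^sup>2 + (y1 s)\<^sup>2 = 1" if "s \<in> I" for s
  proof -
    have "norm (x1 s *\<^sub>R frame_X \<theta> + y1 s *\<^sub>R frame_Y) = 1"
      using unit T that by (auto simp: I_def)
    then have "(x1 s *\<^sub>R frame_X \<theta> + y1 s *\<^sub>R frame_Y) \<bullet> (x1 s *\<^sub>R frame_X \<theta> + y1 s *\<^sub>R frame_Y) = 1"
      by (simp only: power2_norm_eq_inner[symmetric]) simp
    then show ?thesis
      by (subst (asm) inner_add_right) (simp add: frame_inner power2_eq_square)
  qed
  have "x1 0 > 0"
    using orient by (simp add: T[OF I(2)] frame_inner)
  with speed[OF I(2)] y1_0 have x1_0: "x1 0 = 1"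
    by (simp add: power2_eq_1_iff)
  have x2_0: "x2 0 = 0"
  proof -
    have "((\<lambda>s. (x1 s)\<^sup>2 + (y1 s)\<^sup>2) has_real_derivative 2 * x1 0 * x2 0 + 2 * y1 0 * y2 0) (at 0)"
      using x(2)[OF I(2)] y(2)[OF I(2)] by (auto intro!: derivative_eq_intros)
    moreover have "((\<lambda>s. (x1 s)\<^sup>2 + (y1 s)\<^sup>2) has_real_derivative 0) (at 0)"
      by (rule has_field_derivative_transform_within_open[OF DERIV_const[of 1] I]) (simp add: speed)
    ultimately show ?thesis
      using DERIV_unique x1_0 y1_0 by fastforce
  qed

  have pu: "p * u1 0 = - (a 0 2 * sin \<theta>)" and pv: "p * v1 0 = a 2 0 * cos \<theta>"
    using conj x1_0 unfolding x1_def p_def by algebra+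
  (* pairing with the velocity under B extracts the X component x2 of the acceleration, because
     conjugacy makes B(g', -) vanish on the viewing direction *)
  have "p * (a 2 0 * u1 0 * u2 0 + a 0 2 * v1 0 * v2 0) = a 2 0 * a 0 2 * x2 0"
  proof -
    have "p * (a 2 0 * u1 0 * u2 0 + a 0 2 * v1 0 * v2 0) =
        a 2 0 * (p * u1 0) * u2 0 + a 0 2 * (p * v1 0) * v2 0"
      by (simp add: algebra_simps)
    then show ?thesis
      unfolding pu pv x2_def by (simp add: algebra_simps)
  qed
  then have quad: "a 2 0 * u1 0 * u2 0 + a 0 2 * v1 0 * v2 0 = 0"
    using p x2_0 by simp
  have "deriv (signed_curvature \<theta> c) 0 = x1 0 * y3 0 - x3 0 * y1 0"
    by (rule deriv_signed_curvature[OF I c]) (use x y I(2) in auto)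
  then have "p ^ 3 * deriv (signed_curvature \<theta> c) 0 =
      a 3 0 * (p * u1 0) ^ 3 + 3 * a 2 1 * (p * u1 0)\<^sup>2 * (p * v1 0)
      + 3 * a 1 2 * (p * u1 0) * (p * v1 0)\<^sup>2 + a 0 3 * (p * v1 0) ^ 3"
    unfolding x1_0 y1_0 y3_0 quad by (simp add: algebra_simps power2_eq_square power3_eq_cube)
  then show ?thesis
    unfolding pu pv .
qed

section \<open>The linear system for the third order coefficients\<close>

text \<open>
  Dehomogenizing by \<open>t = Y / X\<close> turns the form into a polynomial of degree at most three with four
  distinct roots.
\<close>
lemma cubic_form_zero:
  fixes x :: "real^4" and X Y :: "4 \<Rightarrow> real"
  assumes X: "\<And>i. X i \<noteq> 0" and inj: "inj (\<lambda>i. Y i / X i)"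
    and zero: "\<And>i. x$1 * X i ^ 3 + 3 * x$2 * X i ^ 2 * Y i + 3 * x$3 * X i * Y i ^ 2 + x$4 * Y i ^ 3 = 0"
  shows "x = 0"
proof -
  define c where "c = (\<lambda>k::nat. [x$1, 3 * x$2, 3 * x$3, x$4] ! k)"
  have root: "(\<Sum>k\<le>3. c k * (Y i / X i) ^ k) = 0" for i
  proof -
    have "(\<Sum>k\<le>3. c k * (Y i / X i) ^ k) = x$1 + 3 * x$2 * (Y i / X i) + 3 * x$3 * (Y i / X i) ^ 2 + x$4 * (Y i / X i) ^ 3"
      by (simp add: c_def eval_nat_numeral)
    also have "\<dots> = 0"
      using zero[of i] X[of i] by (simp add: field_simps power2_eq_square power3_eq_cube)
    finally show ?thesis .
  qed
  have c0: "c k = 0" if "k \<le> 3" for k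
  proof (rule ccontr)
    assume "c k \<noteq> 0"
    then have "\<exists>k\<le>3. c k \<noteq> 0"
      using that by blast
    from polyfun_rootbound[OF this]
    have *: "finite {z. (\<Sum>i\<le>3. c i * z ^ i) = 0}" "card {z. (\<Sum>i\<le>3. c i * z ^ i) = 0} \<le> 3"
      by auto
    have "card (range (\<lambda>i. Y i / X i)) \<le> card {z. (\<Sum>i\<le>3. c i * z ^ i) = 0}"
      using root by (intro card_mono *) auto
    then show False
      using *(2) card_image[OF inj] by simp
  qed
  show ?thesis
    using c0[of 0] c0[of 1] c0[of 2] c0[of 3]
    by (simp add: c_def vec_eq_iff forall_4)
qed

lemma of_columns_nth:
  "of_columns b1 b2 b3 b4 $ i $ 1 = b1 $ i" "of_columns b1 b2 b3 b4 $ i $ 2 = b2 $ i"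
  "of_columns b1 b2 b3 b4 $ i $ 3 = b3 $ i" "of_columns b1 b2 b3 b4 $ i $ 4 = b4 $ i"
  using column_of_columns[of b1 b2 b3 b4] by (simp_all add: column_def vec_eq_iff)

lemma of_columns_mult_vec:
  "(of_columns b1 b2 b3 b4 *v x) $ i = b1 $ i * x $ 1 + b2 $ i * x $ 2 + b3 $ i * x $ 3 + b4 $ i * x $ 4"
  by (simp add: matrix_vector_mult_def sum_4 of_columns_nth)

lemma cramer_of_columns:
  assumes "of_columns b1 b2 b3 b4 *v x = d" and "det (of_columns b1 b2 b3 b4) \<noteq> 0"
  shows "x $ 1 = det (of_columns d b2 b3 b4) / det (of_columns b1 b2 b3 b4)"
    and "x $ 2 = det (of_columns b1 d b3 b4) / det (of_columns b1 b2 b3 b4)"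
    and "x $ 3 = det (of_columns b1 b2 d b4) / det (of_columns b1 b2 b3 b4)"
    and "x $ 4 = det (of_columns b1 b2 b3 d) / det (of_columns b1 b2 b3 b4)"
proof -
  let ?A = "of_columns b1 b2 b3 b4"
  have C: "x $ k = det (\<chi> i j. if j = k then d $ i else ?A $ i $ j) / det ?A" for k
    using cramer_lemma[of k ?A x] assms(2) unfolding assms(1) by simp
  have "(\<chi> i j. if j = 1 then d $ i else ?A $ i $ j) = of_columns d b2 b3 b4"
    "(\<chi> i j. if j = 2 then d $ i else ?A $ i $ j) = of_columns b1 d b3 b4"
    "(\<chi> i j. if j = 3 then d $ i else ?A $ i $ j) = of_columns b1 b2 d b4"
    "(\<chi> i j. if j = 4 then d $ i else ?A $ i $ j) = of_columns b1 b2 b3 d"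
    unfolding vec_eq_iff forall_4 by (simp_all add: of_columns_nth)
  with C[of 1] C[of 2] C[of 3] C[of 4] show
    "x $ 1 = det (of_columns d b2 b3 b4) / det ?A" "x $ 2 = det (of_columns b1 d b3 b4) / det ?A"
    "x $ 3 = det (of_columns b1 b2 d b4) / det ?A" "x $ 4 = det (of_columns b1 b2 b3 d) / det ?A"
    by simp_all
qed

lemma inj_cot:
  fixes \<theta> :: "'a \<Rightarrow> real"
  assumes "inj \<theta>" "\<And>i. 0 < \<theta> i \<and> \<theta> i < pi"
  shows "inj (\<lambda>i. cos (\<theta> i) / sin (\<theta> i))"
proof (rule injI)
  fix i j assume eq: "cos (\<theta> i) / sin (\<theta> i) = cos (\<theta> j) / sin (\<theta> j)"
  have "sin (\<theta> i) > 0" "sin (\<theta> j) > 0"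
    using assms(2) by (auto intro: sin_gt_zero)
  with eq have "sin (\<theta> i - \<theta> j) = 0"
    by (simp add: sin_diff field_simps)
  moreover have "\<bar>\<theta> i - \<theta> j\<bar> < pi"
    using assms(2)[of i] assms(2)[of j] by linarith
  ultimately have "\<theta> i - \<theta> j = 0"
    using sin_eq_0_pi[of "\<theta> i - \<theta> j"] by (simp add: abs_less_iff)
  with \<open>inj \<theta>\<close> show "i = j"
    by (simp add: injD)
qed

theorem mainTheorem4:
  fixes U :: "(real \<times> real) set" and h :: "real \<times> real \<Rightarrow> real" and a :: "nat \<Rightarrow> nat \<Rightarrow> real"
    and \<theta> :: "4 \<Rightarrow> real" and c :: "4 \<Rightarrow> real \<Rightarrow> real \<times> real \<times> real"
    and p :: "real \<Rightarrow> real" and a1 a2 a3 a4 d :: "real^4"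
  assumes "normal_form U h a"
    and p_def: "p = (\<lambda>t. a 2 0 * (cos t)\<^sup>2 + a 0 2 * (sin t)\<^sup>2)"
    and "inj \<theta>"
    and "\<And>i. 0 < \<theta> i \<and> \<theta> i < pi"
    and "\<And>i. p (\<theta> i) \<noteq> 0"
    and "\<And>i. arclength_contour U h (\<theta> i) (c i)"
    and "a1 = (\<chi> i. - ((a 0 2)^3 * (sin (\<theta> i))^3))"
    and "a2 = (\<chi> i. 3 * a 2 0 * (a 0 2)\<^sup>2 * (sin (\<theta> i))\<^sup>2 * cos (\<theta> i))"
    and "a3 = (\<chi> i. - (3 * (a 2 0)\<^sup>2 * a 0 2 * sin (\<theta> i) * (cos (\<theta> i))\<^sup>2))"
    and "a4 = (\<chi> i. (a 2 0)^3 * (cos (\<theta> i))^3)"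
    and "d = (\<chi> i. (p (\<theta> i))^3 * deriv (signed_curvature (\<theta> i) (c i)) 0)"
  shows "det (of_columns a1 a2 a3 a4) \<noteq> 0
    \<and> a 3 0 = det (of_columns d a2 a3 a4) / det (of_columns a1 a2 a3 a4)
    \<and> a 2 1 = det (of_columns a1 d a3 a4) / det (of_columns a1 a2 a3 a4)
    \<and> a 1 2 = det (of_columns a1 a2 d a4) / det (of_columns a1 a2 a3 a4)
    \<and> a 0 3 = det (of_columns a1 a2 a3 d) / det (of_columns a1 a2 a3 a4)"
proof -
  let ?A = "of_columns a1 a2 a3 a4"
  let ?X = "\<lambda>i. - (a 0 2 * sin (\<theta> i))" and ?Y = "\<lambda>i. a 2 0 * cos (\<theta> i)"
  have a20: "a 2 0 \<noteq> 0" and a02: "a 0 2 \<noteq> 0"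
    using assms(1) by (auto simp: normal_form_def)
  have A_mult: "(?A *v x) $ i = x$1 * ?X i ^ 3 + 3 * x$2 * ?X i ^ 2 * ?Y i
      + 3 * x$3 * ?X i * ?Y i ^ 2 + x$4 * ?Y i ^ 3" for x i
    unfolding of_columns_mult_vec assms(7-10)
    by (simp add: power2_eq_square power3_eq_cube algebra_simps)

  have "x = 0" if "?A *v x = 0" for x
  proof (rule cubic_form_zero)
    fix i
    show "?X i \<noteq> 0"
      using a02 sin_gt_zero[of "\<theta> i"] assms(4)[of i] by auto
    show "x$1 * ?X i ^ 3 + 3 * x$2 * ?X i ^ 2 * ?Y i + 3 * x$3 * ?X i * ?Y i ^ 2 + x$4 * ?Y i ^ 3 = 0"
      using A_mult[of x i] that by simp
  next
    have "(\<lambda>i. ?Y i / ?X i) = (\<lambda>z. - (a 2 0 / a 0 2) * z) \<circ> (\<lambda>i. cos (\<theta> i) / sin (\<theta> i))"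
      by (simp add: fun_eq_iff)
    moreover have "inj (\<lambda>z. - (a 2 0 / a 0 2) * z)"
      using a20 a02 by (auto intro!: injI)
    ultimately show "inj (\<lambda>i. ?Y i / ?X i)"
      using inj_cot[OF assms(3,4)] by (metis inj_compose)
  qed
  then have "invertible ?A"
    using matrix_left_invertible_ker[of ?A] by (metis invertible_left_inverse)
  then have det: "det ?A \<noteq> 0"
    by (simp add: invertible_det_nz)

  have "(?A *v (vector [a 3 0, a 2 1, a 1 2, a 0 3])) $ i = d $ i" for i
  proof -
    have "p (\<theta> i) = a 2 0 * (cos (\<theta> i))\<^sup>2 + a 0 2 * (sin (\<theta> i))\<^sup>2"
      by (simp add: p_def)
    from curvature_derivative_arclength_contour[OF assms(1) this assms(5) assms(6)]
    show ?thesis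
      unfolding A_mult assms(11) by (simp add: vector_def)
  qed
  then have "?A *v (vector [a 3 0, a 2 1, a 1 2, a 0 3]) = d"
    by (simp add: vec_eq_iff)
  from cramer_of_columns[OF this det] det show ?thesis
    by (simp add: vector_def)
qed

end
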